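(* Let $\alpha\in(0,2)$. Let $X_1,X_2,\dots$ be independent identically distributed real random variables, and for each natural $n$ let $S_n:=\sum_{i=1}^n X_i$. Suppose that the distribution of $X_1$ is symmetric about $0$ and has a probability density function $f$ such that $f(u)\asymp u^{-1-\alpha}$ as $u\to\infty$. Then, for $n\in\mathbb N$ and $x\in(0,\infty)$ varying arbitrarily, $\mathsf P(S_n>x)\to0$ if and only if $$n<<x^{\alpha}.$$ Moreover, if either $n<<x^\alpha$ holds or $\mathsf P(S_n>x)\to0$, then $$\mathsf P(S_n>x)\asymp nx^{-\alpha}.$$
   Context: $\mathbb N=\{1,2,\dots\}$. The number $\alpha$ and the distribution of $X_1$ are fixed, while $n$ and $x$ vary; that is, one considers an arbitrary sequence of pairs $(n,x)=(n_k,x_k)$, $k\to\infty$, and all limits are taken along this sequence (it is not required that $n\to\infty$; $n$ may be fixed). For positive expressions $E$ and $F$ in terms of $n,x$: $E<<F$ means $E=o(F)$, i.e. $E/F\to0$; $E\asymp F$ means that both $\limsup E/F<\infty$ and $\limsup F/E<\infty$. In the condition on $f$, the relation $\asymp$ is understood in the same way with the limit superior taken as $u\to\infty$. *)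

theory Defs
  imports "HOL-Probability.Probability" "HOL-Library.Landau_Symbols"
begin

text \<open>The quotients are taken in the extended reals, where \<open>c / 0 = \<infinity>\<close> for \<open>c > 0\<close>.
  Hence, for nonnegative \<open>E\<close> and positive \<open>G\<close>, the second conjunct forces \<open>E\<close> to be
  eventually positive; real division, with \<open>c / 0 = 0\<close>, would not.\<close>

definition same_order :: "'b filter \<Rightarrow> ('b \<Rightarrow> real) \<Rightarrow> ('b \<Rightarrow> real) \<Rightarrow> bool" where
  "same_order F E G \<longleftrightarrow>
     Limsup F (\<lambda>k. ereal (E k) / ereal (G k)) < \<infinity> \<and>
     Limsup F (\<lambda>k. ereal (G k) / ereal (E k)) < \<infinity>"

definition partial_sum :: "(nat \<Rightarrow> 'a \<Rightarrow> real) \<Rightarrow> nat \<Rightarrow> 'a \<Rightarrow> real" where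
  "partial_sum X n \<omega> = (\<Sum>i=1..n. X i \<omega>)"

end

theory Submission
  imports Defs "HOL-Real_Asymp.Real_Asymp"
begin

text \<open>
  Everything follows from one non-asymptotic estimate: there are \<open>k, K > 0\<close> such that, for all
  \<open>n \<ge> 1\<close> and all \<open>x > 0\<close>,
  \<open>k * min 1 (n * x powr (- \<alpha>)) \<le> P (S n > x) \<le> K * (n * x powr (- \<alpha>))\<close>.
  Since \<open>n << x powr \<alpha>\<close> says that \<open>y = n * x powr (- \<alpha>)\<close> tends to \<open>0\<close>, and the minimum equals \<open>y\<close>
  once \<open>y < 1\<close>, this estimate gives both the equivalence and the exact order
  (\<open>asymptotics_of_two_sided_bound\<close>). The density is integrated to
  \<open>P (\<bar>X 1\<bar> > u) \<asymp> u powr (- \<alpha>)\<close> (\<open>two_sided_tail\<close>), and both bounds follow from this.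

  Lower bound: one large summand suffices. Let \<open>j\<close> be the first index with \<open>\<bar>X j\<bar> > x\<close>, and reverse
  the signs of all other summands. By symmetry this leaves the joint law unchanged, and the sum of
  the old and the new \<open>S n\<close> is \<open>2 * X j\<close>, so one of the two exceeds \<open>x\<close> in absolute value. Hence
  \<open>P (max \<bar>X i\<bar> > x) \<le> 2 * P (\<bar>S n\<bar> > x) = 4 * P (S n > x)\<close> (\<open>levy_ineq\<close>), and by
  independence the left-hand side is comparable to \<open>min 1 (n * P (\<bar>X 1\<bar> > x))\<close>.

  Upper bound: either some \<open>\<bar>X i\<bar>\<close> exceeds \<open>x\<close>, which costs \<open>n * P (\<bar>X 1\<bar> > x)\<close>, or \<open>S n\<close> is the sum
  of the summands truncated at level \<open>x\<close>. These have mean \<open>0\<close> by symmetry, and because \<open>\<alpha> < 2\<close>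
  their second moment is \<open>O(x powr (2 - \<alpha>))\<close> (\<open>truncated_moment_le\<close>), so that
  Chebyshev's inequality gives the same order \<open>n * x powr (- \<alpha>)\<close>.
\<close>

section \<open>Comparability as a two-sided bound\<close>

text \<open>
  Because \<open>G / 0 = \<infinity>\<close> in the extended reals, finiteness of the second upper limit also keeps \<open>E\<close>
  away from \<open>0\<close>; therefore the quotients can be cleared in both directions.
\<close>

lemma same_order_iff:
  assumes E: "eventually (\<lambda>k. 0 \<le> E k) F" and G: "eventually (\<lambda>k. 0 < G k) F"
  shows "same_order F E G \<longleftrightarrow>
    (\<exists>c>0. \<exists>C. eventually (\<lambda>k. c * G k \<le> E k \<and> E k \<le> C * G k) F)"
proof
  assume *: "same_order F E G"
  obtain C where C: "Limsup F (\<lambda>k. ereal (E k) / ereal (G k)) < ereal (real C)"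
    using * less_PInf_Ex_of_nat unfolding same_order_def by auto
  obtain D where D: "Limsup F (\<lambda>k. ereal (G k) / ereal (E k)) < ereal (real D)"
    using * less_PInf_Ex_of_nat unfolding same_order_def by auto
  \<comment> \<open>\<open>D + 1\<close> rather than \<open>D\<close>, which may be \<open>0\<close> when \<open>F\<close> is the trivial filter\<close>
  have "eventually (\<lambda>k. 1 / (real D + 1) * G k \<le> E k \<and> E k \<le> real C * G k) F"
    using E G Limsup_lessD[OF C] Limsup_lessD[OF D]
  proof eventually_elim
    case (elim k)
    have "0 < E k"
    proof (rule ccontr)
      assume "\<not> 0 < E k"
      then have "E k = 0" using elim by simp
      then show False using elim by (simp add: divide_ereal_def)
    qed
    then have "G k < real D * E k" "E k < real C * G k"
      using elim by (simp_all add: pos_divide_less_eq)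
    moreover have "real D * E k \<le> (real D + 1) * E k"
      using elim by (intro mult_right_mono) auto
    ultimately show ?case
      by (simp add: field_simps)
  qed
  then show "\<exists>c>0. \<exists>C. eventually (\<lambda>k. c * G k \<le> E k \<and> E k \<le> C * G k) F"
    by (intro exI[of _ "1 / (real D + 1)"] conjI exI[of _ "real C"]) auto
next
  assume "\<exists>c>0. \<exists>C. eventually (\<lambda>k. c * G k \<le> E k \<and> E k \<le> C * G k) F"
  then obtain c C where c: "c > 0"
    and ev: "eventually (\<lambda>k. c * G k \<le> E k \<and> E k \<le> C * G k) F" by blast
  have "eventually (\<lambda>k. ereal (E k) / ereal (G k) \<le> ereal C) F"
    using G ev by eventually_elim (simp add: pos_divide_le_eq)
  moreover have "eventually (\<lambda>k. ereal (G k) / ereal (E k) \<le> ereal (1 / c)) F"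
    using G ev
  proof eventually_elim
    case (elim k)
    have "0 < c * G k" using c elim by simp
    then have "0 < E k" using elim by linarith
    then show ?case using c elim by (simp add: field_simps)
  qed
  ultimately show "same_order F E G"
    unfolding same_order_def
    by (auto dest!: Limsup_bounded intro: le_less_trans)
qed

section \<open>Sign changes of symmetric variables\<close>

locale iid_symmetric = prob_space M for M :: "'a measure" +
  fixes X :: "nat \<Rightarrow> 'a \<Rightarrow> real"
  assumes indep: "indep_vars (\<lambda>_. borel) X {1..}"
    and ident: "\<And>i. i \<ge> 1 \<Longrightarrow> distr M borel (X i) = distr M borel (X 1)"
    and symm: "distr M borel (\<lambda>\<omega>. - X 1 \<omega>) = distr M borel (X 1)"
begin

abbreviation S :: "nat \<Rightarrow> 'a \<Rightarrow> real" where
  "S \<equiv> partial_sum X"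

lemma X_measurable: "i \<ge> 1 \<Longrightarrow> random_variable borel (X i)"
  using indep by (auto simp: indep_vars_def)

lemma X_1_measurable [measurable]: "random_variable borel (X 1)"
  by (simp add: X_measurable)

lemma S_measurable [measurable]: "random_variable borel (S n)"
  unfolding partial_sum_def by (auto intro!: borel_measurable_sum X_measurable)

lemma distr_sign_mult:
  assumes "i \<ge> 1" "s = 1 \<or> s = - 1"
  shows "distr M borel (\<lambda>\<omega>. s * X i \<omega>) = distr M borel (X i)"
proof -
  note X_measurable[OF \<open>i \<ge> 1\<close>, measurable]
  have "distr M borel (\<lambda>\<omega>. - X i \<omega>) = distr (distr M borel (X i)) borel uminus"
    by (subst distr_distr) (auto simp: comp_def)
  also have "\<dots> = distr (distr M borel (X 1)) borel uminus"
    using ident[OF \<open>i \<ge> 1\<close>] by simp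
  also have "\<dots> = distr M borel (X 1)"
    using symm X_1_measurable by (subst distr_distr) (simp_all add: comp_def)
  finally show ?thesis
    using assms ident[OF \<open>i \<ge> 1\<close>] by auto
qed

lemma joint_distr_sign_mult:
  assumes "n \<ge> 1" and s: "\<And>i. s i = 1 \<or> s i = - 1"
  shows "distr M (PiM {1..n} (\<lambda>_. borel)) (\<lambda>\<omega>. \<lambda>i\<in>{1..n}. s i * X i \<omega>) =
         distr M (PiM {1..n} (\<lambda>_. borel)) (\<lambda>\<omega>. \<lambda>i\<in>{1..n}. X i \<omega>)"
proof -
  have iX: "indep_vars (\<lambda>_. borel) X {1..n}"
    by (rule indep_vars_subset[OF indep]) auto
  then have iY: "indep_vars (\<lambda>_. borel) (\<lambda>i \<omega>. s i * X i \<omega>) {1..n}"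
    by (rule indep_vars_compose2[where Y = "\<lambda>i v. s i * v"]) auto
  have "distr M (PiM {1..n} (\<lambda>_. borel)) (\<lambda>\<omega>. \<lambda>i\<in>{1..n}. s i * X i \<omega>) =
      PiM {1..n} (\<lambda>i. distr M borel (\<lambda>\<omega>. s i * X i \<omega>))"
    using iY \<open>n \<ge> 1\<close>
    by (subst indep_vars_iff_distr_eq_PiM'[symmetric]) (auto simp: indep_vars_def)
  also have "\<dots> = PiM {1..n} (\<lambda>i. distr M borel (X i))"
    using s by (intro PiM_cong distr_sign_mult) auto
  also have "\<dots> = distr M (PiM {1..n} (\<lambda>_. borel)) (\<lambda>\<omega>. \<lambda>i\<in>{1..n}. X i \<omega>)"
    using iX \<open>n \<ge> 1\<close>
    by (intro indep_vars_iff_distr_eq_PiM'[THEN iffD1, symmetric]) (auto simp: X_measurable)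
  finally show ?thesis .
qed

text \<open>
  The symmetry principle behind every reflection below: the signs of the summands may be changed
  by any fixed pattern \<open>s\<close> without affecting the probability of an event described by the joint
  values of \<open>X 1, ..., X n\<close>.
\<close>

lemma prob_sign_mult:
  assumes "n \<ge> 1" and s: "\<And>i. s i = 1 \<or> s i = - 1"
    and D: "Measurable.pred (PiM {1..n} (\<lambda>_. borel)) D"
  shows "\<P>(\<omega> in M. D (\<lambda>i\<in>{1..n}. s i * X i \<omega>)) = \<P>(\<omega> in M. D (\<lambda>i\<in>{1..n}. X i \<omega>))"
proof -
  let ?P = "PiM {1..n} (\<lambda>_. borel) :: (nat \<Rightarrow> real) measure"
  have law: "measure (distr M ?P Z) {g \<in> space ?P. D g} = \<P>(\<omega> in M. D (Z \<omega>))"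
    if Z: "Z \<in> measurable M ?P" for Z
  proof -
    have "Z -` {g \<in> space ?P. D g} \<inter> space M = {\<omega> \<in> space M. D (Z \<omega>)}"
      using measurable_space[OF Z] by auto
    then show ?thesis
      using D by (subst measure_distr[OF Z]) auto
  qed
  have "(\<lambda>\<omega>. \<lambda>i\<in>{1..n}. s i * X i \<omega>) \<in> measurable M ?P"
    "(\<lambda>\<omega>. \<lambda>i\<in>{1..n}. X i \<omega>) \<in> measurable M ?P"
    by (auto intro!: measurable_restrict borel_measurable_times X_measurable)
  from this[THEN law] show ?thesis
    unfolding joint_distr_sign_mult[OF assms(1,2)] by (rule trans[OF sym])
qed

lemma prob_abs_eq:
  assumes "u \<ge> 0" "n \<ge> 1"
  shows "\<P>(\<omega> in M. \<bar>S n \<omega>\<bar> > u) = 2 * \<P>(\<omega> in M. S n \<omega> > u)"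
proof -
  have "\<P>(\<omega> in M. \<bar>S n \<omega>\<bar> > u) = prob ({\<omega> \<in> space M. S n \<omega> > u} \<union> {\<omega> \<in> space M. S n \<omega> < - u})"
    using assms by (intro arg_cong[where f = prob]) auto
  also have "\<dots> = \<P>(\<omega> in M. S n \<omega> > u) + \<P>(\<omega> in M. S n \<omega> < - u)"
    using assms by (intro finite_measure_Union) auto
  also have "\<P>(\<omega> in M. S n \<omega> < - u) = \<P>(\<omega> in M. S n \<omega> > u)"
    using prob_sign_mult[OF \<open>n \<ge> 1\<close>, of "\<lambda>_. - 1" "\<lambda>g. (\<Sum>i=1..n. g i) > u"]
    by (simp add: partial_sum_def sum_negf minus_less_iff less_minus_iff)
  finally show ?thesis by simp
qed

section \<open>Lower bound: one large summand\<close>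

text \<open>
  This is Levy's reflection argument. It is applied on the events \<open>B j\<close> that \<open>j\<close> is the first index
  with \<open>\<bar>X j\<bar> > x\<close>: they are disjoint, and each is defined by absolute values only, hence invariant
  under sign changes.
\<close>

lemma levy_ineq:
  assumes "n \<ge> 1"
  shows "\<P>(\<omega> in M. \<exists>i\<in>{1..n}. \<bar>X i \<omega>\<bar> > x) \<le> 2 * \<P>(\<omega> in M. \<bar>S n \<omega>\<bar> > x)"
proof -
  define B where "B j = {\<omega> \<in> space M. \<bar>X j \<omega>\<bar> > x \<and> (\<forall>i\<in>{1..<j}. \<bar>X i \<omega>\<bar> \<le> x)}" for j
  let ?A = "{\<omega> \<in> space M. \<bar>S n \<omega>\<bar> > x}"
  have meas: "B j \<in> events" if "j \<in> {1..n}" for j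
  proof -
    have "{\<omega> \<in> space M. \<bar>X i \<omega>\<bar> > x} \<in> events" "{\<omega> \<in> space M. \<bar>X i \<omega>\<bar> \<le> x} \<in> events"
      if "i \<ge> 1" for i
      using X_measurable[OF that] by measurable
    then show ?thesis
      unfolding B_def using that
      by (intro sets.sets_Collect_conj sets.sets_Collect_finite_All) auto
  qed
  have disj: "disjoint_family_on B {1..n}"
  proof -
    have "B i \<inter> B j = {}" if "i \<in> {1..n}" "i < j" for i j
      using that by (force simp: B_def)
    then show ?thesis
      unfolding disjoint_family_on_def by (metis Int_commute linorder_neqE_nat)
  qed
  have refl: "prob (B j) \<le> 2 * prob (B j \<inter> ?A)" if j: "j \<in> {1..n}" for j
  proof -
    define s :: "nat \<Rightarrow> real" where "s i = (if i = j then 1 else - 1)" for i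
    define D where "D g \<longleftrightarrow> \<bar>g j\<bar> > x \<and> (\<forall>i\<in>{1..<j}. \<bar>g i\<bar> \<le> x) \<and> \<bar>\<Sum>i=1..n. g i\<bar> > x"
      for g :: "nat \<Rightarrow> real"
    let ?A' = "{\<omega> \<in> space M. \<bar>\<Sum>i=1..n. s i * X i \<omega>\<bar> > x}"
    have D_meas: "Measurable.pred (PiM {1..n} (\<lambda>_. borel)) D"
    proof -
      have coord: "(\<lambda>g. g i) \<in> borel_measurable (PiM {1..n} (\<lambda>_. borel :: real measure))"
        if "i \<in> {1..n}" for i
        using that by (rule measurable_component_singleton)
      have "(\<lambda>g. \<Sum>i=1..n. g i) \<in> borel_measurable (PiM {1..n} (\<lambda>_. borel :: real measure))"
        by (intro borel_measurable_sum coord)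
      then show ?thesis
        unfolding D_def using j
        by (intro pred_intros_logic pred_intros_finite borel_measurable_pred_less
              borel_measurable_abs coord) auto
    qed
    have rv: "random_variable borel (\<lambda>\<omega>. \<Sum>i=1..n. s i * X i \<omega>)"
      by (auto intro!: borel_measurable_sum borel_measurable_times X_measurable)
    \<comment> \<open>the sum and its reflection average to \<open>X j\<close>, so they cannot both be small on \<open>B j\<close>\<close>
    have "(\<Sum>i=1..n. s i * X i \<omega>) = (\<Sum>i=1..n. (if i = j then 2 * X i \<omega> else 0) - X i \<omega>)" for \<omega>
      by (intro sum.cong) (auto simp: s_def)
    then have "(\<Sum>i=1..n. s i * X i \<omega>) = 2 * X j \<omega> - S n \<omega>" for \<omega>
      using j by (simp add: sum_subtractf partial_sum_def)
    then have "B j \<subseteq> (B j \<inter> ?A) \<union> (B j \<inter> ?A')"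
      unfolding B_def by auto
    then have "prob (B j) \<le> prob ((B j \<inter> ?A) \<union> (B j \<inter> ?A'))"
      using meas[OF j] rv by (intro finite_measure_mono) auto
    also have "\<dots> \<le> prob (B j \<inter> ?A) + prob (B j \<inter> ?A')"
      using meas[OF j] rv by (intro measure_Un_le) auto
    \<comment> \<open>the reflected event is the same event \<open>D\<close>, evaluated at the reflected variables\<close>
    also have "B j \<inter> ?A' = {\<omega> \<in> space M. D (\<lambda>i\<in>{1..n}. s i * X i \<omega>)}"
      using j unfolding B_def D_def s_def by (auto simp: abs_mult)
    also have "prob \<dots> = \<P>(\<omega> in M. D (\<lambda>i\<in>{1..n}. X i \<omega>))"
      using \<open>n \<ge> 1\<close> D_meas by (intro prob_sign_mult) (auto simp: s_def)
    also have "{\<omega> \<in> space M. D (\<lambda>i\<in>{1..n}. X i \<omega>)} = B j \<inter> ?A"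
      using j unfolding B_def D_def partial_sum_def by auto
    finally show ?thesis by simp
  qed
  have first: "{\<omega> \<in> space M. \<exists>i\<in>{1..n}. \<bar>X i \<omega>\<bar> > x} \<subseteq> (\<Union>j\<in>{1..n}. B j)"
  proof safe
    fix \<omega> i assume \<omega>: "\<omega> \<in> space M" "i \<in> {1..n}" "x < \<bar>X i \<omega>\<bar>"
    define j where "j = (LEAST j. j \<in> {1..n} \<and> x < \<bar>X j \<omega>\<bar>)"
    have "j \<in> {1..n} \<and> x < \<bar>X j \<omega>\<bar>"
      unfolding j_def by (rule LeastI[of _ i]) (use \<omega> in auto)
    moreover from this have "\<bar>X i \<omega>\<bar> \<le> x" if "i \<in> {1..<j}" for i
      using not_less_Least[of i "\<lambda>j. j \<in> {1..n} \<and> x < \<bar>X j \<omega>\<bar>"] that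
      unfolding j_def[symmetric] by auto
    ultimately show "\<omega> \<in> (\<Union>j\<in>{1..n}. B j)"
      using \<omega>(1) by (auto simp: B_def)
  qed
  have "\<P>(\<omega> in M. \<exists>i\<in>{1..n}. \<bar>X i \<omega>\<bar> > x) \<le> prob (\<Union>j\<in>{1..n}. B j)"
    using first meas by (intro finite_measure_mono) auto
  also have "\<dots> \<le> (\<Sum>j=1..n. prob (B j))"
    using meas by (intro finite_measure_subadditive_finite) auto
  also have "\<dots> \<le> (\<Sum>j=1..n. 2 * prob (B j \<inter> ?A))"
    using refl by (intro sum_mono) auto
  also have "\<dots> = 2 * prob (\<Union>j\<in>{1..n}. B j \<inter> ?A)"
    using meas disj
    by (subst finite_measure_finite_Union)
       (auto simp: sum_distrib_left disjoint_family_on_def)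
  also have "\<dots> \<le> 2 * prob ?A"
    by (intro mult_left_mono finite_measure_mono) auto
  finally show ?thesis .
qed

lemma prob_X_eq:
  assumes "i \<ge> 1" and [measurable]: "Measurable.pred borel Q"
  shows "\<P>(\<omega> in M. Q (X i \<omega>)) = \<P>(\<omega> in M. Q (X 1 \<omega>))"
proof -
  have "measure (distr M borel (X i)) {v. Q v} = \<P>(\<omega> in M. Q (X i \<omega>))" if "i \<ge> 1" for i
    by (subst measure_distr[OF X_measurable[OF that]])
       (auto intro!: arg_cong[where f = prob])
  from this[of i] this[of 1] show ?thesis
    using assms ident[of i] by simp
qed

text \<open>
  By independence the probability equals \<open>1 - (1 - p) ^ n\<close>. Bernoulli's inequality gives
  \<open>(1 - p) ^ n * (1 + n * p) \<le> ((1 - p) * (1 + p)) ^ n \<le> 1\<close>, so with \<open>y = n * p\<close> it is at least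
  \<open>y / (1 + y)\<close>, which is at least \<open>min 1 y / 2\<close>.
\<close>

lemma prob_max_ge:
  assumes "n \<ge> 1" and p: "p = \<P>(\<omega> in M. \<bar>X 1 \<omega>\<bar> > x)"
  shows "\<P>(\<omega> in M. \<exists>i\<in>{1..n}. \<bar>X i \<omega>\<bar> > x) \<ge> min 1 (n * p) / 2"
proof -
  have [measurable]: "random_variable borel (X i)" if "i \<in> {1..n}" for i
    using that by (simp add: X_measurable)
  have p01: "0 \<le> p" "p \<le> 1"
    by (auto simp: p)
  have "prob (X i -` {-x..x} \<inter> space M) = 1 - p" if "i \<in> {1..n}" for i
  proof -
    have "prob (X i -` {-x..x} \<inter> space M) = \<P>(\<omega> in M. \<not> \<bar>X i \<omega>\<bar> > x)"
      by (intro arg_cong[where f = prob]) auto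
    also have "\<dots> = 1 - \<P>(\<omega> in M. \<bar>X i \<omega>\<bar> > x)"
      using that by (intro prob_neg) auto
    finally show ?thesis
      using that prob_X_eq[of i "\<lambda>v. \<bar>v\<bar> > x"] by (simp add: p)
  qed
  then have small: "prob (\<Inter>i\<in>{1..n}. X i -` {-x..x} \<inter> space M) = (1 - p) ^ n"
    using assms by (subst indep_varsD[OF indep]) auto
  have "\<P>(\<omega> in M. \<exists>i\<in>{1..n}. \<bar>X i \<omega>\<bar> > x)
      = \<P>(\<omega> in M. \<not> (\<forall>i\<in>{1..n}. \<bar>X i \<omega>\<bar> \<le> x))"
    by (intro arg_cong[where f = prob]) (auto simp: not_le)
  also have "\<dots> = 1 - \<P>(\<omega> in M. \<forall>i\<in>{1..n}. \<bar>X i \<omega>\<bar> \<le> x)"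
    by (intro prob_neg) measurable
  also have "{\<omega> \<in> space M. \<forall>i\<in>{1..n}. \<bar>X i \<omega>\<bar> \<le> x} = (\<Inter>i\<in>{1..n}. X i -` {-x..x} \<inter> space M)"
    using assms(1) by (auto simp: abs_le_iff)
  finally have eq: "\<P>(\<omega> in M. \<exists>i\<in>{1..n}. \<bar>X i \<omega>\<bar> > x) = 1 - (1 - p) ^ n"
    using small by simp
  have "(1 - p) ^ n * (1 + n * p) \<le> (1 - p) ^ n * (1 + p) ^ n"
    using p01 by (intro mult_left_mono Bernoulli_inequality) auto
  also have "\<dots> = (1 - p\<^sup>2) ^ n"
    by (simp add: power_mult_distrib[symmetric] algebra_simps power2_eq_square)
  also have "\<dots> \<le> 1"
    using p01 by (intro power_le_one) (auto simp: power_le_one)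
  finally have *: "(1 - p) ^ n * (1 + n * p) \<le> 1" .
  define y where "y = n * p"
  have "y \<ge> 0" using p01 by (simp add: y_def)
  have "(1 - p) ^ n \<le> 1 / (1 + y)"
    using * \<open>y \<ge> 0\<close> by (simp add: y_def field_simps)
  moreover have "1 / (1 + y) \<le> 1 - min 1 y / 2"
  proof (cases "y \<le> 1")
    case True
    have "y * y \<le> y * 1" using True \<open>y \<ge> 0\<close> by (intro mult_left_mono) auto
    then have "1 \<le> (1 - y / 2) * (1 + y)" by (simp add: algebra_simps)
    then show ?thesis using True \<open>y \<ge> 0\<close> by (simp add: pos_divide_le_eq)
  next
    case False
    then show ?thesis by (simp add: field_simps)
  qed
  ultimately show ?thesis
    unfolding eq y_def[symmetric] by linarith
qed

text \<open>
  The constant collects a factor 2 each from \<open>prob_max_ge\<close>, from \<open>levy_ineq\<close> and from passing from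
  the two-sided to the one-sided tail.
\<close>

lemma prob_sum_ge:
  assumes "x \<ge> 0" "n \<ge> 1"
  shows "\<P>(\<omega> in M. S n \<omega> > x) \<ge> min 1 (n * \<P>(\<omega> in M. \<bar>X 1 \<omega>\<bar> > x)) / 8"
  using prob_max_ge[OF \<open>n \<ge> 1\<close> refl, of x] levy_ineq[OF \<open>n \<ge> 1\<close>, of x] prob_abs_eq[OF assms]
  by linarith

end

section \<open>Upper bound: truncation\<close>

definition truncate_at :: "real \<Rightarrow> real \<Rightarrow> real" where
  "truncate_at x v = (if \<bar>v\<bar> \<le> x then v else 0)"

lemma truncate_at_measurable [measurable]: "truncate_at x \<in> borel_measurable borel"
  unfolding truncate_at_def by measurable

lemma abs_truncate_at_le: "\<bar>truncate_at x v\<bar> \<le> \<bar>x\<bar>"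
  by (auto simp: truncate_at_def)

lemma truncate_at_minus: "truncate_at x (- v) = - truncate_at x v"
  by (simp add: truncate_at_def)

context iid_symmetric
begin

definition truncated_moment :: "real \<Rightarrow> real" where
  "truncated_moment x = expectation (\<lambda>\<omega>. (truncate_at x (X 1 \<omega>))\<^sup>2)"

lemma integrable_truncate_at:
  assumes "i \<ge> 1" "j \<ge> 1"
  shows "integrable M (\<lambda>\<omega>. truncate_at x (X i \<omega>))"
    and "integrable M (\<lambda>\<omega>. truncate_at x (X i \<omega>) * truncate_at x (X j \<omega>))"
proof -
  note [measurable] = assms[THEN X_measurable]
  show "integrable M (\<lambda>\<omega>. truncate_at x (X i \<omega>))"
    by (rule integrable_const_bound[where B = "\<bar>x\<bar>"]) (auto simp: abs_truncate_at_le)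
  show "integrable M (\<lambda>\<omega>. truncate_at x (X i \<omega>) * truncate_at x (X j \<omega>))"
  proof (rule integrable_const_bound[where B = "\<bar>x\<bar> * \<bar>x\<bar>"])
    have "norm (truncate_at x v * truncate_at x w) \<le> \<bar>x\<bar> * \<bar>x\<bar>" for v w
      unfolding real_norm_def abs_mult by (intro mult_mono abs_truncate_at_le) auto
    then show "AE \<omega> in M. norm (truncate_at x (X i \<omega>) * truncate_at x (X j \<omega>)) \<le> \<bar>x\<bar> * \<bar>x\<bar>"
      by blast
  qed measurable
qed

lemma expectation_X_eq:
  fixes g :: "real \<Rightarrow> real"
  assumes [measurable]: "g \<in> borel_measurable borel" and "i \<ge> 1"
  shows "expectation (\<lambda>\<omega>. g (X i \<omega>)) = expectation (\<lambda>\<omega>. g (X 1 \<omega>))"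
proof -
  have "(\<integral>v. g v \<partial>distr M borel (X j)) = expectation (\<lambda>\<omega>. g (X j \<omega>))" if "j \<ge> 1" for j
    using X_measurable[OF that] by (intro integral_distr) auto
  from this[of i] this[of 1] show ?thesis
    using ident[OF \<open>i \<ge> 1\<close>] \<open>i \<ge> 1\<close> by simp
qed

text \<open>
  Truncating at a level symmetric about \<open>0\<close> keeps the distribution symmetric, so no centring is
  needed in Chebyshev's inequality.
\<close>

lemma expectation_truncate_at:
  assumes "i \<ge> 1"
  shows "expectation (\<lambda>\<omega>. truncate_at x (X i \<omega>)) = 0"
proof -
  have "expectation (\<lambda>\<omega>. truncate_at x (X 1 \<omega>)) = (\<integral>v. truncate_at x v \<partial>distr M borel (X 1))"
    by (rule integral_distr[symmetric]) measurable
  also have "\<dots> = (\<integral>v. truncate_at x v \<partial>distr M borel (\<lambda>\<omega>. - X 1 \<omega>))"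
    by (simp only: symm)
  also have "\<dots> = expectation (\<lambda>\<omega>. truncate_at x (- X 1 \<omega>))"
    by (rule integral_distr) measurable
  also have "\<dots> = - expectation (\<lambda>\<omega>. truncate_at x (X 1 \<omega>))"
    by (simp add: truncate_at_minus)
  finally show ?thesis
    using expectation_X_eq[OF truncate_at_measurable assms] by simp
qed

text \<open>
  The mixed products vanish because the truncated summands are independent with mean \<open>0\<close>.
\<close>

lemma second_moment_truncated_sum:
  "expectation (\<lambda>\<omega>. (\<Sum>i=1..n. truncate_at x (X i \<omega>))\<^sup>2) = n * truncated_moment x"
proof -
  let ?Y = "\<lambda>i \<omega>. truncate_at x (X i \<omega>)"
  have cross: "expectation (\<lambda>\<omega>. ?Y i \<omega> * ?Y j \<omega>) = (if i = j then truncated_moment x else 0)"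
    if "i \<in> {1..n}" "j \<in> {1..n}" for i j
  proof (cases "i = j")
    case True
    then show ?thesis
      using that expectation_X_eq[of "\<lambda>v. (truncate_at x v)\<^sup>2" i]
      by (simp add: truncated_moment_def power2_eq_square)
  next
    case False
    have "indep_vars (\<lambda>_. borel) X {i, j}"
      using that by (intro indep_vars_subset[OF indep]) auto
    then have "indep_vars (\<lambda>_. borel) ?Y {i, j}"
      by (rule indep_vars_compose2) measurable
    then have "expectation (\<lambda>\<omega>. \<Prod>k\<in>{i, j}. ?Y k \<omega>) = (\<Prod>k\<in>{i, j}. expectation (?Y k))"
      using that by (intro indep_vars_lebesgue_integral) (auto intro!: integrable_truncate_at)
    then show ?thesis
      using False that expectation_truncate_at by simp
  qed
  have "expectation (\<lambda>\<omega>. (\<Sum>i=1..n. ?Y i \<omega>)\<^sup>2)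
      = expectation (\<lambda>\<omega>. \<Sum>i=1..n. \<Sum>j=1..n. ?Y i \<omega> * ?Y j \<omega>)"
    by (simp add: power2_eq_square sum_product)
  also have "\<dots> = (\<Sum>i=1..n. \<Sum>j=1..n. expectation (\<lambda>\<omega>. ?Y i \<omega> * ?Y j \<omega>))"
    by (subst Bochner_Integration.integral_sum,
        intro Bochner_Integration.integrable_sum integrable_truncate_at, simp, simp)
       (intro sum.cong refl Bochner_Integration.integral_sum integrable_truncate_at, auto)
  also have "\<dots> = (\<Sum>i=1..n. \<Sum>j=1..n. if i = j then truncated_moment x else 0)"
    by (intro sum.cong refl cross)
  also have "\<dots> = n * truncated_moment x"
    by simp
  finally show ?thesis .
qed

text \<open>
  Outside the event that some \<open>\<bar>X i\<bar>\<close> exceeds \<open>x\<close>, truncation at \<open>x\<close> does not alter the sum.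
\<close>

lemma prob_sum_le:
  assumes "x > 0"
  shows "\<P>(\<omega> in M. S n \<omega> > x) \<le> n * \<P>(\<omega> in M. \<bar>X 1 \<omega>\<bar> > x) + n * truncated_moment x / x\<^sup>2"
proof -
  let ?T = "\<lambda>\<omega>. \<Sum>i=1..n. truncate_at x (X i \<omega>)"
  let ?B = "\<lambda>i. {\<omega> \<in> space M. \<bar>X i \<omega>\<bar> > x}"
  have B: "?B i \<in> events" if "i \<in> {1..n}" for i
  proof -
    have [measurable]: "random_variable borel (X i)"
      using that by (simp add: X_measurable)
    show ?thesis by measurable
  qed
  have T [measurable]: "random_variable borel ?T"
    by (intro borel_measurable_sum measurable_compose[OF X_measurable]) auto
  have Bs: "(\<Union>i\<in>{1..n}. ?B i) \<in> events"
    using B by (intro sets.finite_UN) auto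
  have Ts: "{\<omega> \<in> space M. \<bar>?T \<omega>\<bar> \<ge> x} \<in> events"
    by measurable
  have "integrable M (\<lambda>\<omega>. (?T \<omega>)\<^sup>2)"
    unfolding power2_eq_square sum_product
    by (intro Bochner_Integration.integrable_sum integrable_truncate_at) auto
  then have cheb: "\<P>(\<omega> in M. \<bar>?T \<omega>\<bar> \<ge> x) \<le> n * truncated_moment x / x\<^sup>2"
    using second_moment_method[OF T _ \<open>x > 0\<close>] by (simp only: second_moment_truncated_sum)
  have "{\<omega> \<in> space M. S n \<omega> > x} \<subseteq> (\<Union>i\<in>{1..n}. ?B i) \<union> {\<omega> \<in> space M. \<bar>?T \<omega>\<bar> \<ge> x}"
  proof
    fix \<omega> assume \<omega>: "\<omega> \<in> {\<omega> \<in> space M. S n \<omega> > x}"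
    have "S n \<omega> = ?T \<omega>" if "\<forall>i\<in>{1..n}. \<bar>X i \<omega>\<bar> \<le> x"
      using that by (simp add: partial_sum_def truncate_at_def)
    then show "\<omega> \<in> (\<Union>i\<in>{1..n}. ?B i) \<union> {\<omega> \<in> space M. \<bar>?T \<omega>\<bar> \<ge> x}"
      using \<omega> by (cases "\<forall>i\<in>{1..n}. \<bar>X i \<omega>\<bar> \<le> x") (simp_all add: not_le, force+)
  qed
  then have "\<P>(\<omega> in M. S n \<omega> > x) \<le> prob ((\<Union>i\<in>{1..n}. ?B i) \<union> {\<omega> \<in> space M. \<bar>?T \<omega>\<bar> \<ge> x})"
    using Bs Ts by (intro finite_measure_mono sets.Un)
  also have "\<dots> \<le> prob (\<Union>i\<in>{1..n}. ?B i) + \<P>(\<omega> in M. \<bar>?T \<omega>\<bar> \<ge> x)"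
    using Bs Ts by (rule measure_Un_le)
  also have "prob (\<Union>i\<in>{1..n}. ?B i) \<le> (\<Sum>i=1..n. prob (?B i))"
    using B by (intro finite_measure_subadditive_finite) auto
  also have "\<dots> = (\<Sum>i=1..n. prob (?B 1))"
    by (intro sum.cong refl prob_X_eq) auto
  also have "\<dots> = n * prob (?B 1)"
    by simp
  finally show ?thesis
    using cheb by linarith
qed

lemma truncated_moment_le_square: "truncated_moment x \<le> x\<^sup>2"
proof -
  have "truncated_moment x \<le> expectation (\<lambda>_. x\<^sup>2)"
    unfolding truncated_moment_def power2_eq_square
    by (intro integral_mono integrable_truncate_at)
       (auto intro!: abs_le_square_iff[THEN iffD1, unfolded power2_eq_square] abs_truncate_at_le)
  then show ?thesis by (simp add: prob_space)
qed

text \<open>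
  The values that are lost when the truncation level drops from \<open>x\<close> to \<open>x / 2\<close> have squares at most
  \<open>x\<^sup>2\<close> and occur only when \<open>\<bar>X 1\<bar> > x / 2\<close>.
\<close>

lemma truncated_moment_halving:
  assumes "x > 0"
  shows "truncated_moment x \<le> truncated_moment (x / 2) + x\<^sup>2 * \<P>(\<omega> in M. \<bar>X 1 \<omega>\<bar> > x / 2)"
proof -
  let ?B = "{\<omega> \<in> space M. \<bar>X 1 \<omega>\<bar> > x / 2}"
  have B: "?B \<in> events" by measurable
  have "truncated_moment x \<le> expectation (\<lambda>\<omega>. (truncate_at (x / 2) (X 1 \<omega>))\<^sup>2 + x\<^sup>2 * indicator ?B \<omega>)"
    unfolding truncated_moment_def
  proof (rule integral_mono)
    show "integrable M (\<lambda>\<omega>. (truncate_at x (X 1 \<omega>))\<^sup>2)"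
      by (auto simp: power2_eq_square intro!: integrable_truncate_at)
    show "integrable M (\<lambda>\<omega>. (truncate_at (x / 2) (X 1 \<omega>))\<^sup>2 + x\<^sup>2 * indicator ?B \<omega>)"
      unfolding power2_eq_square using B
      by (intro Bochner_Integration.integrable_add integrable_truncate_at integrable_mult_right
            integrable_real_indicator) (auto simp: emeasure_eq_measure)
    show "(truncate_at x (X 1 \<omega>))\<^sup>2 \<le> (truncate_at (x / 2) (X 1 \<omega>))\<^sup>2 + x\<^sup>2 * indicator ?B \<omega>"
      if "\<omega> \<in> space M" for \<omega>
      using that assms abs_le_square_iff[of "X 1 \<omega>" x]
      by (auto simp: truncate_at_def indicator_def)
  qed
  also have "\<dots> = truncated_moment (x / 2) + x\<^sup>2 * prob ?B"
    unfolding truncated_moment_def power2_eq_square using B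
    by (subst Bochner_Integration.integral_add)
       (auto intro!: integrable_truncate_at simp: emeasure_eq_measure)
  finally show ?thesis .
qed

text \<open>
  Halving the truncation level repeatedly turns the tail bound into a geometric series of ratio
  \<open>r = 2 powr (\<alpha> - 2)\<close>, which is less than \<open>1\<close> exactly because \<open>\<alpha> < 2\<close>. The constant \<open>K\<close> is the fixed
  point of \<open>K * r + C * 2 powr \<alpha> = K\<close>, so that the bound \<open>K * u powr (2 - \<alpha>)\<close> reproduces itself
  under one halving; the remainder after \<open>m\<close> halvings is at most \<open>(u / 2 ^ m)\<^sup>2\<close> and vanishes.
\<close>

lemma truncated_moment_le:
  assumes "\<alpha> < 2" and "x > 0" and "C \<ge> 0"
    and tail: "\<And>u. u > 0 \<Longrightarrow> \<P>(\<omega> in M. \<bar>X 1 \<omega>\<bar> > u) \<le> C * u powr (- \<alpha>)"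
  shows "truncated_moment x \<le> C * 2 powr \<alpha> / (1 - 2 powr (\<alpha> - 2)) * x powr (2 - \<alpha>)"
proof -
  define r where "r = 2 powr (\<alpha> - 2)"
  define K where "K = C * 2 powr \<alpha> / (1 - r)"
  have r: "0 < r" "r < 1"
    using \<open>\<alpha> < 2\<close> by (auto simp: r_def powr_less_one)
  have K: "K * r + C * 2 powr \<alpha> = K"
    using r by (simp add: K_def field_simps)
  have half: "truncated_moment u \<le> truncated_moment (u / 2) + C * 2 powr \<alpha> * u powr (2 - \<alpha>)" if "u > 0" for u
  proof -
    have "u\<^sup>2 * \<P>(\<omega> in M. \<bar>X 1 \<omega>\<bar> > u / 2) \<le> u\<^sup>2 * (C * (u / 2) powr (- \<alpha>))"
      using that by (intro mult_left_mono tail) auto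
    also have "\<dots> = C * 2 powr \<alpha> * u powr (2 - \<alpha>)"
      using that by (simp add: powr_divide powr_minus powr_diff field_simps)
    finally show ?thesis
      using truncated_moment_halving[OF that] by linarith
  qed
  have "truncated_moment u \<le> K * u powr (2 - \<alpha>) + (u / 2 ^ m)\<^sup>2" if "u > 0" for m u
    using that
  proof (induction m arbitrary: u)
    case 0
    have "0 \<le> K * u powr (2 - \<alpha>)"
      using r \<open>C \<ge> 0\<close> by (simp add: K_def)
    then show ?case
      using truncated_moment_le_square[of u] by simp
  next
    case (Suc m)
    have "(u / 2) powr (2 - \<alpha>) = r * u powr (2 - \<alpha>)"
      using Suc.prems by (simp add: r_def powr_divide powr_diff field_simps)
    then have "truncated_moment u \<le> (K * r + C * 2 powr \<alpha>) * u powr (2 - \<alpha>) + (u / 2 / 2 ^ m)\<^sup>2"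
      using half[of u] Suc.IH[of "u / 2"] Suc.prems by (simp add: algebra_simps)
    then show ?case
      unfolding K by simp
  qed
  moreover have "(\<lambda>m. K * x powr (2 - \<alpha>) + (x / 2 ^ m)\<^sup>2) \<longlonglongrightarrow> K * x powr (2 - \<alpha>) + 0\<^sup>2"
    by (intro tendsto_intros) real_asymp
  ultimately show ?thesis
    using \<open>x > 0\<close> unfolding K_def r_def
    by (intro LIMSEQ_le_const[where a = "truncated_moment x"]) auto
qed

lemma prob_sum_le_powr:
  assumes "\<alpha> < 2" "C \<ge> 0"
    and tail: "\<And>u. u > 0 \<Longrightarrow> \<P>(\<omega> in M. \<bar>X 1 \<omega>\<bar> > u) \<le> C * u powr (- \<alpha>)"
  shows "\<exists>K. \<forall>n. \<forall>x>0. \<P>(\<omega> in M. S n \<omega> > x) \<le> K * (n * x powr (- \<alpha>))"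
proof -
  define D where "D = C * 2 powr \<alpha> / (1 - 2 powr (\<alpha> - 2))"
  have "\<P>(\<omega> in M. S n \<omega> > x) \<le> (C + D) * (n * x powr (- \<alpha>))" if "x > 0" for n x
  proof -
    have "truncated_moment x \<le> D * x powr (2 - \<alpha>)"
      unfolding D_def using assms that by (intro truncated_moment_le) auto
    also have "x powr (2 - \<alpha>) = x powr (- \<alpha>) * x\<^sup>2"
      using that by (simp add: powr_diff powr_minus field_simps)
    finally have "truncated_moment x / x\<^sup>2 \<le> D * x powr (- \<alpha>)"
      using that by (simp add: pos_divide_le_eq mult.assoc)
    then have "\<P>(\<omega> in M. \<bar>X 1 \<omega>\<bar> > x) + truncated_moment x / x\<^sup>2 \<le> (C + D) * x powr (- \<alpha>)"
      using tail[OF that] by (simp add: distrib_right)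
    then have "n * (\<P>(\<omega> in M. \<bar>X 1 \<omega>\<bar> > x) + truncated_moment x / x\<^sup>2) \<le> n * ((C + D) * x powr (- \<alpha>))"
      by (rule mult_left_mono) simp
    then show ?thesis
      using prob_sum_le[OF that, of n] by (simp add: algebra_simps)
  qed
  then show ?thesis by blast
qed

end

section \<open>Tails from the density\<close>

lemma nn_integral_power_tail:
  assumes "0 < \<alpha>" "0 < u" "0 \<le> C"
  shows "(\<integral>\<^sup>+t. ennreal (C * t powr (- 1 - \<alpha>)) * indicator {u<..} t \<partial>lborel)
    = ennreal (C / \<alpha> * u powr (- \<alpha>))"
proof -
  have "(\<integral>\<^sup>+t. ennreal (C * t powr (- 1 - \<alpha>)) * indicator {u<..} t \<partial>lborel)
      = (\<integral>\<^sup>+t. ennreal (C * t powr (- 1 - \<alpha>)) * indicator {u..} t \<partial>lborel)"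
    using AE_lborel_singleton[of u]
    by (intro nn_integral_cong_AE) (auto elim!: eventually_mono simp: indicator_def)
  also have "\<dots> = ennreal (0 - (- (C / \<alpha>) * u powr (- \<alpha>)))"
  proof (rule nn_integral_FTC_atLeast)
    show "((\<lambda>t. - (C / \<alpha>) * t powr (- \<alpha>)) has_real_derivative C * t powr (- 1 - \<alpha>)) (at t)"
      if "u \<le> t" for t
    proof -
      have "t > 0" using that \<open>0 < u\<close> by simp
      then have "((\<lambda>t. - (C / \<alpha>) * t powr (- \<alpha>)) has_real_derivative
          - (C / \<alpha>) * (- \<alpha> * t powr (- \<alpha> - 1))) (at t)"
        by (intro DERIV_cmult has_real_derivative_powr)
      moreover have "- \<alpha> - 1 = - 1 - \<alpha>" by simp
      ultimately show ?thesis
        using \<open>0 < \<alpha>\<close> by simp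
    qed
    show "((\<lambda>t. - (C / \<alpha>) * t powr (- \<alpha>)) \<longlongrightarrow> 0) at_top"
      using \<open>0 < \<alpha>\<close> by (intro tendsto_mult_right_zero tendsto_neg_powr filterlim_ident) simp
  qed (use assms in auto)
  finally show ?thesis by simp
qed

lemma (in prob_space) tail_of_density:
  assumes Y: "distributed M lborel Y (\<lambda>u. ennreal (f u))"
    and "0 < \<alpha>" "0 < a" "0 < c"
    and f: "\<And>u. u \<ge> a \<Longrightarrow> c * u powr (- 1 - \<alpha>) \<le> f u \<and> f u \<le> C * u powr (- 1 - \<alpha>)"
    and "u \<ge> a"
  shows "c / \<alpha> * u powr (- \<alpha>) \<le> \<P>(\<omega> in M. Y \<omega> > u)"
    and "\<P>(\<omega> in M. Y \<omega> > u) \<le> C / \<alpha> * u powr (- \<alpha>)"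
proof -
  have "u > 0" using assms by simp
  have "0 < c * u powr (- 1 - \<alpha>)" using \<open>u > 0\<close> \<open>0 < c\<close> by simp
  also have "\<dots> \<le> C * u powr (- 1 - \<alpha>)" using f[OF \<open>u \<ge> a\<close>] by linarith
  finally have "C > 0" using zero_less_mult_pos2[of C "u powr (- 1 - \<alpha>)"] \<open>u > 0\<close> by simp
  let ?I = "\<lambda>g. \<integral>\<^sup>+t. ennreal (g t) * indicator {u<..} t \<partial>lborel"
  have "Y -` {u<..} \<inter> space M = {\<omega> \<in> space M. Y \<omega> > u}" by auto
  then have p: "ennreal (\<P>(\<omega> in M. Y \<omega> > u)) = ?I f"
    using distributed_emeasure[OF Y, of "{u<..}"] by (simp add: emeasure_eq_measure)
  have "?I (\<lambda>t. c * t powr (- 1 - \<alpha>)) \<le> ?I f" "?I f \<le> ?I (\<lambda>t. C * t powr (- 1 - \<alpha>))"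
    using f \<open>u \<ge> a\<close>
    by (auto intro!: nn_integral_mono ennreal_leI simp: indicator_def)
  then have "ennreal (c / \<alpha> * u powr (- \<alpha>)) \<le> ennreal (\<P>(\<omega> in M. Y \<omega> > u))"
    "ennreal (\<P>(\<omega> in M. Y \<omega> > u)) \<le> ennreal (C / \<alpha> * u powr (- \<alpha>))"
    unfolding p using nn_integral_power_tail[OF \<open>0 < \<alpha>\<close> \<open>u > 0\<close>] \<open>0 < c\<close> \<open>0 < C\<close> by simp_all
  then show "c / \<alpha> * u powr (- \<alpha>) \<le> \<P>(\<omega> in M. Y \<omega> > u)"
    "\<P>(\<omega> in M. Y \<omega> > u) \<le> C / \<alpha> * u powr (- \<alpha>)"
    using \<open>0 < C\<close> \<open>0 < \<alpha>\<close> by simp_all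
qed

context iid_symmetric
begin

text \<open>
  The density is controlled only beyond \<open>a\<close>. Below \<open>a\<close>, the upper bound follows from \<open>P \<le> 1\<close> by
  enlarging \<open>D\<close>, and the lower bound from monotonicity of the tail; since a tail probability cannot
  exceed \<open>1\<close>, the lower bound near \<open>u = 0\<close> is stated with a minimum.
\<close>

lemma two_sided_tail:
  assumes Y: "distributed M lborel (X 1) (\<lambda>u. ennreal (f u))"
    and "0 < \<alpha>" "0 < a" "0 < c"
    and f: "\<And>u. u \<ge> a \<Longrightarrow> c * u powr (- 1 - \<alpha>) \<le> f u \<and> f u \<le> C * u powr (- 1 - \<alpha>)"
  obtains d D where "0 < d" "0 \<le> D"
    "\<And>u. u > 0 \<Longrightarrow> d * min 1 (u powr (- \<alpha>)) \<le> \<P>(\<omega> in M. \<bar>X 1 \<omega>\<bar> > u)"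
    "\<And>u. u > 0 \<Longrightarrow> \<P>(\<omega> in M. \<bar>X 1 \<omega>\<bar> > u) \<le> D * u powr (- \<alpha>)"
proof
  let ?p = "\<lambda>u. \<P>(\<omega> in M. \<bar>X 1 \<omega>\<bar> > u)"
  let ?d = "2 * c / \<alpha> * min 1 (a powr (- \<alpha>))"
  let ?D = "max (2 * C / \<alpha>) (a powr \<alpha>)"
  show "0 < ?d" "0 \<le> ?D"
    using assms by (auto simp: le_max_iff_disj)
  have p: "?p u = 2 * \<P>(\<omega> in M. X 1 \<omega> > u)" if "u > 0" for u
    using prob_abs_eq[of u 1] that by (simp add: partial_sum_def)
  have large: "2 * c / \<alpha> * u powr (- \<alpha>) \<le> ?p u" "?p u \<le> 2 * C / \<alpha> * u powr (- \<alpha>)"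
    if "u \<ge> a" for u
    using tail_of_density[OF Y \<open>0 < \<alpha>\<close> \<open>0 < a\<close> \<open>0 < c\<close> f that] p[of u] that \<open>0 < a\<close> by simp_all
  fix u :: real assume "u > 0"
  show "?d * min 1 (u powr (- \<alpha>)) \<le> ?p u"
  proof (cases "u \<ge> a")
    case True
    have "?d * min 1 (u powr (- \<alpha>)) \<le> (2 * c / \<alpha> * 1) * u powr (- \<alpha>)"
      using assms by (intro mult_mono) auto
    then show ?thesis
      using large(1)[OF True] by simp
  next
    case False
    have "?d * min 1 (u powr (- \<alpha>)) \<le> (2 * c / \<alpha> * a powr (- \<alpha>)) * 1"
      using assms by (intro mult_mono) auto
    also have "\<dots> \<le> ?p a"
      using large(1)[of a] by simp
    also have "\<dots> \<le> ?p u"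
      using False borel_measurable_abs[OF X_1_measurable]
      by (intro finite_measure_mono) (auto intro: borel_measurable_less)
    finally show ?thesis .
  qed
  show "?p u \<le> ?D * u powr (- \<alpha>)"
  proof (cases "u \<ge> a")
    case True
    have "2 * C / \<alpha> * u powr (- \<alpha>) \<le> ?D * u powr (- \<alpha>)"
      by (intro mult_right_mono) auto
    then show ?thesis
      using large(2)[OF True] by linarith
  next
    case False
    have "?p u \<le> 1" by simp
    also have "1 \<le> a powr \<alpha> * u powr (- \<alpha>)"
      using False \<open>u > 0\<close> \<open>0 < \<alpha>\<close> powr_mono2[of \<alpha> u a] by (simp add: powr_minus field_simps)
    also have "\<dots> \<le> ?D * u powr (- \<alpha>)"
      by (intro mult_right_mono) auto
    finally show ?thesis .
  qed
qed

text \<open>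
  Capping the one-variable tail at \<open>1\<close> costs nothing here, because
  \<open>min 1 (n * t) \<le> n * min 1 t\<close> for \<open>n \<ge> 1\<close>. The factor \<open>min 1 d\<close> keeps the bound below
  the outer minimum of \<open>prob_sum_ge\<close> when \<open>d > 1\<close>.
\<close>

lemma prob_sum_ge_powr:
  assumes "0 < d"
    and tail: "\<And>u. u > 0 \<Longrightarrow> d * min 1 (u powr (- \<alpha>)) \<le> \<P>(\<omega> in M. \<bar>X 1 \<omega>\<bar> > u)"
    and "n \<ge> 1" "x > 0"
  shows "min 1 d / 8 * min 1 (n * x powr (- \<alpha>)) \<le> \<P>(\<omega> in M. S n \<omega> > x)"
proof -
  let ?p = "\<P>(\<omega> in M. \<bar>X 1 \<omega>\<bar> > x)"
  have "min 1 d * min 1 (n * x powr (- \<alpha>)) \<le> 1 * 1"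
    using \<open>0 < d\<close> by (intro mult_mono) auto
  moreover have "min 1 d * min 1 (n * x powr (- \<alpha>)) \<le> n * ?p"
  proof -
    have "min 1 (n * x powr (- \<alpha>)) \<le> n * min 1 (x powr (- \<alpha>))"
    proof (cases "x powr (- \<alpha>) \<le> 1")
      case False
      then show ?thesis using \<open>n \<ge> 1\<close> mult_mono[of 1 "real n" 1 "x powr (- \<alpha>)"] by simp
    qed simp
    then have "min 1 d * min 1 (n * x powr (- \<alpha>)) \<le> d * (n * min 1 (x powr (- \<alpha>)))"
      using \<open>0 < d\<close> by (intro mult_mono) auto
    also have "\<dots> = n * (d * min 1 (x powr (- \<alpha>)))"
      by simp
    also have "\<dots> \<le> n * ?p"
      using tail[OF \<open>x > 0\<close>] by (intro mult_left_mono) auto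
    finally show ?thesis .
  qed
  ultimately have "min 1 d * min 1 (n * x powr (- \<alpha>)) \<le> min 1 (n * ?p)"
    by simp
  then show ?thesis
    using prob_sum_ge[OF less_imp_le[OF \<open>x > 0\<close>] \<open>n \<ge> 1\<close>] by linarith
qed

end

section \<open>From the two-sided bound to the asymptotics\<close>

text \<open>
  If \<open>p\<close> tends to \<open>0\<close>, then eventually \<open>p < c\<close>; the lower bound then forces \<open>y < 1\<close>, where it reads
  \<open>c * y \<le> p\<close>.
\<close>

lemma asymptotics_of_two_sided_bound:
  fixes p y :: "'b \<Rightarrow> real"
  assumes "0 < c" and y: "\<And>k. 0 < y k"
    and lower: "\<And>k. c * min 1 (y k) \<le> p k" and upper: "\<And>k. p k \<le> C * y k"
  shows "(p \<longlongrightarrow> 0) F \<longleftrightarrow> (y \<longlongrightarrow> 0) F"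
    and "(y \<longlongrightarrow> 0) F \<Longrightarrow> same_order F p y"
proof -
  have p: "0 \<le> p k" for k
    using lower[of k] y[of k] \<open>0 < c\<close> mult_nonneg_nonneg[of c "min 1 (y k)"] by linarith
  show "(p \<longlongrightarrow> 0) F \<longleftrightarrow> (y \<longlongrightarrow> 0) F"
  proof
    assume "(y \<longlongrightarrow> 0) F"
    then have "((\<lambda>k. C * y k) \<longlongrightarrow> 0) F"
      by (rule tendsto_mult_right_zero)
    then show "(p \<longlongrightarrow> 0) F"
      by (rule tendsto_sandwich[OF _ _ tendsto_const, rotated 2]) (auto simp: p upper)
  next
    assume p0: "(p \<longlongrightarrow> 0) F"
    have lim: "((\<lambda>k. p k / c) \<longlongrightarrow> 0) F"
      using tendsto_divide[OF p0 tendsto_const, of c] \<open>0 < c\<close> by simp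
    have "eventually (\<lambda>k. p k < c) F"
      using p0 \<open>0 < c\<close> by (rule order_tendstoD)
    then have "eventually (\<lambda>k. y k \<le> p k / c) F"
    proof eventually_elim
      case (elim k)
      then have "c * min 1 (y k) < c * 1"
        using lower[of k] by simp
      then have "min 1 (y k) = y k"
        using \<open>0 < c\<close> by (auto simp: min_def split: if_splits)
      then show ?case
        using lower[of k] \<open>0 < c\<close> by (simp add: field_simps)
    qed
    then show "(y \<longlongrightarrow> 0) F"
      by (intro tendsto_sandwich[OF _ _ tendsto_const lim]) (simp_all add: less_imp_le[OF y])
  qed
  show "same_order F p y" if "(y \<longlongrightarrow> 0) F"
  proof -
    have "eventually (\<lambda>k. y k < 1) F"
      using that by (rule order_tendstoD) simp
    then have "eventually (\<lambda>k. c * y k \<le> p k \<and> p k \<le> C * y k) F"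
    proof eventually_elim
      case (elim k)
      then show ?case using lower[of k] upper[of k] by simp
    qed
    then show ?thesis
      using \<open>0 < c\<close> p y by (subst same_order_iff) auto
  qed
qed

theorem proposition2:
  fixes M :: "'a measure"
    and X :: "nat \<Rightarrow> 'a \<Rightarrow> real"
    and f :: "real \<Rightarrow> real"
    and \<alpha> :: real
    and n :: "nat \<Rightarrow> nat"
    and x :: "nat \<Rightarrow> real"
  assumes "0 < \<alpha>" and "\<alpha> < 2"
    and "prob_space M"
    and "prob_space.indep_vars M (\<lambda>_. borel) X {1..}"
    and "\<And>i. i \<ge> 1 \<Longrightarrow> distr M borel (X i) = distr M borel (X 1)"
    and "distr M borel (\<lambda>\<omega>. - X 1 \<omega>) = distr M borel (X 1)"
    and "\<And>u. 0 \<le> f u"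
    and "distributed M lborel (X 1) (\<lambda>u. ennreal (f u))"
    and "same_order at_top f (\<lambda>u. u powr (- 1 - \<alpha>))"
    and "\<And>k. n k \<ge> 1"
    and "\<And>k. x k > 0"
  shows "((\<lambda>k. \<P>(\<omega> in M. partial_sum X (n k) \<omega> > x k)) \<longlonglongrightarrow> 0 \<longleftrightarrow>
           (\<lambda>k. real (n k)) \<in> o(\<lambda>k. x k powr \<alpha>)) \<and>
         ((\<lambda>k. real (n k)) \<in> o(\<lambda>k. x k powr \<alpha>) \<or>
           (\<lambda>k. \<P>(\<omega> in M. partial_sum X (n k) \<omega> > x k)) \<longlonglongrightarrow> 0 \<longrightarrow>
         same_order sequentially
           (\<lambda>k. \<P>(\<omega> in M. partial_sum X (n k) \<omega> > x k))
           (\<lambda>k. real (n k) * x k powr (- \<alpha>)))"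
proof -
  interpret iid_symmetric M X
    by (rule iid_symmetric.intro[OF assms(3) iid_symmetric_axioms.intro[OF assms(4-6)]])
  have "eventually (\<lambda>u::real. 0 < u powr (- 1 - \<alpha>)) at_top"
    using eventually_gt_at_top[of 0] by eventually_elim simp
  then obtain c C where "c > 0" and
    "eventually (\<lambda>u. c * u powr (- 1 - \<alpha>) \<le> f u \<and> f u \<le> C * u powr (- 1 - \<alpha>)) at_top"
    using same_order_iff[of f at_top "\<lambda>u. u powr (- 1 - \<alpha>)"] assms(7,9) by auto
  then obtain a0 where a0:
    "\<And>u. u \<ge> a0 \<Longrightarrow> c * u powr (- 1 - \<alpha>) \<le> f u \<and> f u \<le> C * u powr (- 1 - \<alpha>)"
    by (auto simp: eventually_at_top_linorder)
  obtain d D where d: "0 < d" "0 \<le> D"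
    "\<And>u. u > 0 \<Longrightarrow> d * min 1 (u powr (- \<alpha>)) \<le> \<P>(\<omega> in M. \<bar>X 1 \<omega>\<bar> > u)"
    "\<And>u. u > 0 \<Longrightarrow> \<P>(\<omega> in M. \<bar>X 1 \<omega>\<bar> > u) \<le> D * u powr (- \<alpha>)"
    by (rule two_sided_tail[OF assms(8) \<open>0 < \<alpha>\<close>, of "max 1 a0" c C]) (use \<open>c > 0\<close> a0 in auto)
  obtain K where K: "\<And>n x. x > 0 \<Longrightarrow> \<P>(\<omega> in M. S n \<omega> > x) \<le> K * (n * x powr (- \<alpha>))"
    using prob_sum_le_powr[OF \<open>\<alpha> < 2\<close> d(2,4)] by blast
  let ?p = "\<lambda>k. \<P>(\<omega> in M. S (n k) \<omega> > x k)"
  let ?y = "\<lambda>k. real (n k) * x k powr (- \<alpha>)"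
  have pos: "0 < min 1 d / 8" "0 < ?y k" for k
    using d(1) assms(10)[of k] assms(11)[of k] by simp_all
  have lower: "min 1 d / 8 * min 1 (?y k) \<le> ?p k" for k
    by (rule prob_sum_ge_powr[OF d(1,3) assms(10,11)])
  have upper: "?p k \<le> K * ?y k" for k
    by (rule K[OF assms(11)])
  have y: "?y = (\<lambda>k. real (n k) / x k powr \<alpha>)"
    by (auto simp: powr_minus divide_inverse)
  \<comment> \<open>\<open>n << x powr \<alpha>\<close> in terms of the quantity \<open>y\<close> of the two-sided bound\<close>
  have small: "(\<lambda>k. real (n k)) \<in> o(\<lambda>k. x k powr \<alpha>) \<longleftrightarrow> ?y \<longlonglongrightarrow> 0"
  proof
    assume "(\<lambda>k. real (n k)) \<in> o(\<lambda>k. x k powr \<alpha>)"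
    then show "?y \<longlonglongrightarrow> 0"
      unfolding y by (rule smalloD_tendsto)
  next
    assume "?y \<longlonglongrightarrow> 0"
    moreover have "x k powr \<alpha> \<noteq> 0" for k
      using assms(11)[of k] by simp
    ultimately show "(\<lambda>k. real (n k)) \<in> o(\<lambda>k. x k powr \<alpha>)"
      unfolding y by (intro smalloI_tendsto) auto
  qed
  show ?thesis
    unfolding small
    using asymptotics_of_two_sided_bound[where p = ?p and y = ?y, OF pos lower upper, of sequentially]
    by blast
qed

end
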